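(* Let $X,Y,\sigma,\omega,f=(f_1,\dots,f_r)$ and $\xi_1,\dots,\xi_m$ be as in the context. Let $\mathcal{N}\subset\mathcal{O}(\mathbb{A}^r)=\mathbb{Z}[x_1,\dots,x_r]$ be an $f$-admissible free $\mathbb{Z}$-module of rank $N$ with basis $\mathfrak{m}_1,\dots,\mathfrak{m}_N$, let $\mathfrak{f}_i=\mathfrak{m}_i\circ f$ and $Q^\sigma_N=\left(\int_\sigma\mathfrak{f}_i\mathfrak{f}_j\,\omega\right)_{1\le i,j\le N}$. Let $D^\ell_N,D^r_N\in\mathrm{GL}_N(\mathbb{Q})$ be matrices such that all entries of $D^\ell_NQ^\sigma_ND^r_N$ are integral linear forms in the $\xi_i$ (i.e. lie in $\mathbb{Z}\xi_1+\cdots+\mathbb{Z}\xi_m$), and let $\delta_N=|\det(D^\ell_N)\det(D^r_N)|$. If $N$ is sufficiently large (larger than a constant depending only on $\sigma$ and $\omega$) and $\det Q^\sigma_N\neq0$, then there exist integers $n_1,\dots,n_m$ such that $\sum_{i=1}^mn_i\xi_i$ is a rational linear combination of Mellin integrals $I(a_1,\dots,a_r)$ (with integers $a_i\ge0$) and $$0<\left|\sum_{i=1}^mn_i\xi_i\right|\le\left(t_{\mathcal{N}}(f(\sigma))^2\,\delta_N\right)^{1/N}.$$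
   Context: Setting: $X$ is a smooth affine algebraic variety of dimension $d$ over $\mathbb{Q}$; $\omega$ is a regular differential $d$-form on $X$; $Y\subset X$ is a divisor over $\mathbb{Q}$; $\sigma\subset X(\mathbb{C})$ is a (compact) relative $d$-chain with boundary contained in $Y(\mathbb{C})$; $f=(f_1,\dots,f_r):X\to\mathbb{A}^r$ is a morphism over $\mathbb{Q}$. The Mellin integrals are $I(n_1,\dots,n_r)=\int_\sigma f_1^{n_1}\cdots f_r^{n_r}\,\omega$ for integers $n_i\ge0$; they are assumed real. $\xi_1,\dots,\xi_m$ are fixed periods such that $I(n_1,\dots,n_r)\in\mathbb{Q}\xi_1+\cdots+\mathbb{Q}\xi_m$ for all integers $n_i\ge0$. A free $\mathbb{Z}$-module $\mathcal{N}\subset\mathbb{Z}[x_1,\dots,x_r]$ is $f$-admissible if the pullback $f^*$, $\mathfrak{m}\mapsto\mathfrak{m}\circ f$, is injective on $\mathcal{N}$. For $\mathcal{N}$ of rank $N$ with basis $\mathfrak{m}_1,\dots,\mathfrak{m}_N$ and a set $\tau\subset\mathbb{C}^r$, $$t_{\mathcal{N}}(\tau)=\sup_{(z_1,\dots,z_N)\in\tau^N}\left|\det(\mathfrak{m}_j(z_i))_{1\le i,j\le N}\right|,$$ independent of the choice of basis. *)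

theory Defs
  imports
    "HOL-Analysis.Analysis"
    "HOL-Homology.Homology"
    "HOL-Library.Function_Algebras"
    "HOL-Library.Poly_Mapping"
    "Jordan_Normal_Form.Determinant"
begin

text \<open>
  Dimensions occur as bound variables below (in the definition of a period), so affine spaces
  are not indexed by types: a point of affine \<open>n\<close>-space over the complex numbers is a sequence that
  vanishes from index \<open>n\<close> on, with the subspace topology of the product topology.
  Coordinates are numbered from \<open>0\<close>.
\<close>

type_synonym cpoint = "nat \<Rightarrow> complex"

type_synonym 'a mpoly_nat = "(nat \<Rightarrow>\<^sub>0 nat) \<Rightarrow>\<^sub>0 'a"

definition affine_space :: "nat \<Rightarrow> cpoint set" where
  "affine_space n = {x. \<forall>i\<ge>n. x i = 0}"

subsection \<open>Polynomials\<close>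

definition poly_in_vars :: "nat \<Rightarrow> 'a::zero mpoly_nat \<Rightarrow> bool" where
  "poly_in_vars n p \<longleftrightarrow> (\<forall>m\<in>Poly_Mapping.keys p. Poly_Mapping.keys m \<subseteq> {..<n})"

text \<open>The first argument embeds the coefficient ring (\<open>of_int\<close> or \<open>of_rat\<close>).\<close>

definition poly_eval :: "('a::zero \<Rightarrow> complex) \<Rightarrow> 'a mpoly_nat \<Rightarrow> cpoint \<Rightarrow> complex" where
  "poly_eval \<iota> p x =
     (\<Sum>m\<in>Poly_Mapping.keys p. \<iota> (Poly_Mapping.lookup p m) *
        (\<Prod>i\<in>Poly_Mapping.keys m. x i ^ Poly_Mapping.lookup m i))"

subsection \<open>Affine varieties over the rationals\<close>

text \<open>
  A (reduced, not necessarily irreducible) affine variety over the rationals, embedded in affine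
  \<open>n\<close>-space, is identified with its set of complex points; its coordinate ring is then the ring of
  restrictions of rational polynomials to these points.
\<close>

definition closed_over_Q :: "nat \<Rightarrow> cpoint set \<Rightarrow> bool" where
  "closed_over_Q n Z \<longleftrightarrow>
     (\<exists>P :: rat mpoly_nat set. (\<forall>p\<in>P. poly_in_vars n p) \<and>
        Z = {x\<in>affine_space n. \<forall>p\<in>P. poly_eval of_rat p x = 0})"

definition irreducible_over_Q :: "nat \<Rightarrow> cpoint set \<Rightarrow> bool" where
  "irreducible_over_Q n Z \<longleftrightarrow> closed_over_Q n Z \<and> Z \<noteq> {} \<and>
     (\<forall>A B. closed_over_Q n A \<and> closed_over_Q n B \<and> Z = A \<union> B \<longrightarrow> Z = A \<or> Z = B)"

definition irreducible_component :: "nat \<Rightarrow> cpoint set \<Rightarrow> cpoint set \<Rightarrow> bool" where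
  "irreducible_component n Z C \<longleftrightarrow> irreducible_over_Q n C \<and> C \<subseteq> Z \<and>
     (\<forall>C'. irreducible_over_Q n C' \<and> C \<subseteq> C' \<and> C' \<subseteq> Z \<longrightarrow> C' = C)"

definition irreducible_chain :: "nat \<Rightarrow> cpoint set \<Rightarrow> nat \<Rightarrow> (nat \<Rightarrow> cpoint set) \<Rightarrow> bool" where
  "irreducible_chain n Z k C \<longleftrightarrow>
     (\<forall>i\<le>k. irreducible_over_Q n (C i) \<and> C i \<subseteq> Z) \<and> (\<forall>i<k. C i \<subset> C (Suc i))"

definition has_dimension :: "nat \<Rightarrow> cpoint set \<Rightarrow> nat \<Rightarrow> bool" where
  "has_dimension n Z k \<longleftrightarrow>
     (\<exists>C. irreducible_chain n Z k C) \<and> \<not> (\<exists>C. irreducible_chain n Z (Suc k) C)"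

definition partial_deriv :: "nat \<Rightarrow> (cpoint \<Rightarrow> complex) \<Rightarrow> cpoint \<Rightarrow> complex" where
  "partial_deriv i h x = deriv (\<lambda>u. h (x(i := u))) (x i)"

definition tangent_space :: "nat \<Rightarrow> cpoint set \<Rightarrow> cpoint \<Rightarrow> cpoint set" where
  "tangent_space n X x =
     {v\<in>affine_space n. \<forall>p :: rat mpoly_nat.
        poly_in_vars n p \<and> (\<forall>y\<in>X. poly_eval of_rat p y = 0) \<longrightarrow>
        (\<Sum>i<n. partial_deriv i (poly_eval of_rat p) x * v i) = 0}"

lemma vector_space_cpoint: "vector_space (\<lambda>(c::complex) (v::cpoint) i. c * v i)"
  by unfold_locales (auto simp: fun_eq_iff algebra_simps)

text \<open>
  The Jacobian criterion: the Zariski tangent space has dimension \<open>d\<close> at every complex point.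
  In particular all irreducible components of \<open>X\<close> have dimension \<open>d\<close>.
\<close>

definition smooth_affine_variety :: "nat \<Rightarrow> nat \<Rightarrow> cpoint set \<Rightarrow> bool" where
  "smooth_affine_variety n d X \<longleftrightarrow> closed_over_Q n X \<and> has_dimension n X d \<and>
     (\<forall>x\<in>X. vector_space.dim (\<lambda>(c::complex) (v::cpoint) i. c * v i) (tangent_space n X x) = d)"

text \<open>Divisors enter only through their support, which may be empty.\<close>

definition divisor_on :: "nat \<Rightarrow> nat \<Rightarrow> cpoint set \<Rightarrow> cpoint set \<Rightarrow> bool" where
  "divisor_on n d X Y \<longleftrightarrow> closed_over_Q n Y \<and> Y \<subseteq> X \<and>
     (\<forall>C. irreducible_component n Y C \<longrightarrow> (\<exists>k. Suc k = d \<and> has_dimension n C k))"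

definition regular_function :: "nat \<Rightarrow> cpoint set \<Rightarrow> (cpoint \<Rightarrow> complex) \<Rightarrow> bool" where
  "regular_function n X h \<longleftrightarrow>
     (\<exists>p :: rat mpoly_nat. poly_in_vars n p \<and> (\<forall>x\<in>X. h x = poly_eval of_rat p x))"

definition morphism_to_affine_space :: "nat \<Rightarrow> cpoint set \<Rightarrow> nat \<Rightarrow> (cpoint \<Rightarrow> cpoint) \<Rightarrow> bool" where
  "morphism_to_affine_space n X r f \<longleftrightarrow>
     f ` X \<subseteq> affine_space r \<and> (\<forall>i<r. regular_function n X (\<lambda>x. f x i))"

subsection \<open>Differential forms and integration\<close>

text \<open>
  The module of regular \<open>d\<close>-forms on the closed subvariety \<open>X\<close> of affine space is generated over
  the coordinate ring of \<open>X\<close> by the restrictions of the \<open>dx\<^sub>I = dx\<^sub>i\<^sub>1 \<and> \<dots> \<and> dx\<^sub>i\<^sub>d\<close>, where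
  \<open>I = {i\<^sub>1 < \<dots> < i\<^sub>d}\<close> is a \<open>d\<close>-subset of \<open>{..<n}\<close>. A form is given by its coefficients \<open>\<omega> I\<close>.
\<close>

type_synonym diff_form = "nat set \<Rightarrow> cpoint \<Rightarrow> complex"

definition form_indices :: "nat \<Rightarrow> nat \<Rightarrow> nat set set" where
  "form_indices n d = {I. I \<subseteq> {..<n} \<and> card I = d}"

definition regular_form :: "nat \<Rightarrow> nat \<Rightarrow> cpoint set \<Rightarrow> diff_form \<Rightarrow> bool" where
  "regular_form n d X \<omega> \<longleftrightarrow> (\<forall>I\<in>form_indices n d. regular_function n X (\<omega> I))"

definition scale_form :: "(cpoint \<Rightarrow> complex) \<Rightarrow> diff_form \<Rightarrow> diff_form" where
  "scale_form h \<omega> = (\<lambda>I x. h x * \<omega> I x)"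

text \<open>
  The standard \<open>d\<close>-simplex is parametrised by its last \<open>d\<close> barycentric coordinates. Only the
  entries \<open>t 0, \<dots>, t (d - 1)\<close> of \<open>t\<close> matter, so the two sets below are cylinders.
\<close>

definition barycentric :: "nat \<Rightarrow> (nat \<Rightarrow> real) \<Rightarrow> nat \<Rightarrow> real" where
  "barycentric d t i = (if i = 0 then 1 - (\<Sum>j<d. t j) else if i \<le> d then t (i - 1) else 0)"

definition closed_corner :: "nat \<Rightarrow> (nat \<Rightarrow> real) set" where
  "closed_corner d = {t. (\<forall>j<d. 0 \<le> t j) \<and> (\<Sum>j<d. t j) \<le> 1}"

definition open_corner :: "nat \<Rightarrow> (nat \<Rightarrow> real) set" where
  "open_corner d = {t. (\<forall>j<d. 0 < t j) \<and> (\<Sum>j<d. t j) < 1}"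

text \<open>
  A simplex is \<open>C\<^sup>1\<close> if in the coordinates \<open>t 0, \<dots>, t (d - 1)\<close> it extends to a continuously
  differentiable map on a neighbourhood of the closed simplex.
\<close>

definition C1_simplex :: "nat \<Rightarrow> nat \<Rightarrow> ((nat \<Rightarrow> real) \<Rightarrow> cpoint) \<Rightarrow> bool" where
  "C1_simplex n d s \<longleftrightarrow>
     (\<exists>U g. open U \<and> closed_corner d \<subseteq> U \<and>
        (\<forall>t\<in>closed_corner d. \<forall>i<n. g t i = s (barycentric d t) i) \<and>
        (\<forall>i<n. \<forall>j<d. \<exists>g'. continuous_on U g' \<and>
           (\<forall>t\<in>U. ((\<lambda>u. g (t(j := u)) i) has_vector_derivative g' t) (at (t j)))))"

text \<open>A relative chain is a \<open>C\<^sup>1\<close> singular chain in \<open>X\<close> whose boundary is a chain in \<open>Y\<close>.\<close>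

definition relative_chain ::
  "nat \<Rightarrow> nat \<Rightarrow> cpoint set \<Rightarrow> cpoint set \<Rightarrow> cpoint chain \<Rightarrow> bool" where
  "relative_chain n d X Y \<sigma> \<longleftrightarrow>
     singular_relcycle d (top_of_set X) Y \<sigma> \<and> (\<forall>s\<in>Poly_Mapping.keys \<sigma>. C1_simplex n d s)"

definition chain_support :: "nat \<Rightarrow> cpoint chain \<Rightarrow> cpoint set" where
  "chain_support d \<sigma> = (\<Union>s\<in>Poly_Mapping.keys \<sigma>. s ` standard_simplex d)"

text \<open>
  Integral of the pullback of \<open>\<omega>\<close> along \<open>s\<close>. The domain is the open simplex, because the partial
  derivatives of \<open>s\<close> on the faces (a null set) need not exist as two-sided derivatives.
\<close>

definition simplex_integral :: "nat \<Rightarrow> nat \<Rightarrow> ((nat \<Rightarrow> real) \<Rightarrow> cpoint) \<Rightarrow> diff_form \<Rightarrow> complex" where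
  "simplex_integral n d s \<omega> =
     set_lebesgue_integral (Pi\<^sub>M {..<d} (\<lambda>_. lborel)) (open_corner d)
       (\<lambda>t. \<Sum>I\<in>form_indices n d. \<omega> I (s (barycentric d t)) *
          Determinant.det (Matrix.mat d d (\<lambda>(k, j).
            vector_derivative (\<lambda>u. s (barycentric d (t(j := u))) (sorted_list_of_set I ! k))
              (at (t j)))))"

definition chain_integral :: "nat \<Rightarrow> nat \<Rightarrow> cpoint chain \<Rightarrow> diff_form \<Rightarrow> complex" where
  "chain_integral n d \<sigma> \<omega> =
     (\<Sum>s\<in>Poly_Mapping.keys \<sigma>. of_int (Poly_Mapping.lookup \<sigma> s) * simplex_integral n d s \<omega>)"

text \<open>Periods in the sense of Kontsevich and Zagier.\<close>

definition is_period :: "complex \<Rightarrow> bool" where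
  "is_period \<xi> \<longleftrightarrow>
     (\<exists>n d X Y \<omega> \<sigma>. smooth_affine_variety n d X \<and> divisor_on n d X Y \<and> regular_form n d X \<omega> \<and>
        relative_chain n d X Y \<sigma> \<and> \<xi> = chain_integral n d \<sigma> \<omega>)"

definition mellin_integral ::
  "nat \<Rightarrow> nat \<Rightarrow> cpoint chain \<Rightarrow> diff_form \<Rightarrow> nat \<Rightarrow> (cpoint \<Rightarrow> cpoint) \<Rightarrow> (nat \<Rightarrow> nat) \<Rightarrow> complex" where
  "mellin_integral n d \<sigma> \<omega> r f a = chain_integral n d \<sigma> (scale_form (\<lambda>x. \<Prod>i<r. f x i ^ a i) \<omega>)"

subsection \<open>Modules of integer polynomials\<close>

definition is_Z_basis :: "nat \<Rightarrow> (nat \<Rightarrow> int mpoly_nat) \<Rightarrow> int mpoly_nat set \<Rightarrow> bool" where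
  "is_Z_basis N m M \<longleftrightarrow>
     M = {\<Sum>i<N. of_int (c i) * m i | c :: nat \<Rightarrow> int. True} \<and>
     (\<forall>c :: nat \<Rightarrow> int. (\<Sum>i<N. of_int (c i) * m i) = 0 \<longrightarrow> (\<forall>i<N. c i = 0))"

text \<open>Pullbacks are compared as functions on the complex points of \<open>X\<close>.\<close>

definition admissible :: "cpoint set \<Rightarrow> (cpoint \<Rightarrow> cpoint) \<Rightarrow> int mpoly_nat set \<Rightarrow> bool" where
  "admissible X f M \<longleftrightarrow> inj_on (\<lambda>p. restrict (\<lambda>x. poly_eval of_int p (f x)) X) M"

text \<open>Meaningful for bounded \<open>\<tau>\<close>, where the supremum is finite.\<close>

definition sup_det :: "nat \<Rightarrow> (nat \<Rightarrow> int mpoly_nat) \<Rightarrow> cpoint set \<Rightarrow> real" where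
  "sup_det N m \<tau> =
     Sup {cmod (Determinant.det (Matrix.mat N N (\<lambda>(i, j). poly_eval of_int (m j) (z i)))) | z.
            \<forall>i<N. z i \<in> \<tau>}"

definition Q_matrix ::
  "nat \<Rightarrow> nat \<Rightarrow> cpoint chain \<Rightarrow> diff_form \<Rightarrow> (cpoint \<Rightarrow> cpoint) \<Rightarrow> nat \<Rightarrow> (nat \<Rightarrow> int mpoly_nat) \<Rightarrow>
     complex Matrix.mat" where
  "Q_matrix n d \<sigma> \<omega> f N m = Matrix.mat N N (\<lambda>(i, j).
     chain_integral n d \<sigma>
       (scale_form (\<lambda>x. poly_eval of_int (m i) (f x) * poly_eval of_int (m j) (f x)) \<omega>))"

end

theory Submission
  imports Defs
begin

text \<open>
  Andreief's identity writes \<open>N! det Q\<close> as the integral of \<open>det (m\<^sub>j (f (z\<^sub>i)))\<^sup>2\<close> over the \<open>N\<close>-fold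
  product of the chain, so that \<open>N! \<bar>det Q\<bar> \<le> t\<^sup>2 C\<^sup>N\<close>, where \<open>C\<close> is the total mass of \<open>\<omega>\<close> along the
  chain. As \<open>C\<^sup>N \<le> N!\<close> for large \<open>N\<close>, the real matrix \<open>L = D\<^sub>l Q D\<^sub>r\<close> satisfies
  \<open>0 < \<bar>det L\<bar> \<le> t\<^sup>2 \<delta>\<close>. Minkowski's theorem is not needed to produce a small integral form: let \<open>G\<close>
  be the additive group generated by the entries of \<open>L\<close>. If no nonzero element of \<open>G\<close> had absolute
  value at most \<open>\<bar>det L\<bar>\<^sup>1\<^sup>/\<^sup>N\<close>, then \<open>G\<close> would be generated by some \<open>g > \<bar>det L\<bar>\<^sup>1\<^sup>/\<^sup>N\<close>, and \<open>L = g B\<close>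
  with an integral matrix \<open>B\<close> would give \<open>\<bar>det L\<bar> \<ge> g\<^sup>N\<close>.
\<close>

subsection \<open>Small integral combinations of the entries of a matrix\<close>

text \<open>Distinct elements of \<open>G\<close> are more than \<open>\<rho>\<close> apart, so the
  infimum of the positive ones is attained, and division with remainder by this minimum leaves
  nothing over.\<close>

lemma cyclic_or_small_element:
  fixes G :: "real set" and \<rho> :: real
  assumes diff: "\<And>x y. x \<in> G \<Longrightarrow> y \<in> G \<Longrightarrow> x - y \<in> G"
    and \<rho>: "\<rho> > 0" and large: "\<And>x. x \<in> G \<Longrightarrow> x \<noteq> 0 \<Longrightarrow> \<bar>x\<bar> > \<rho>"
  shows "\<exists>g>\<rho>. \<forall>x\<in>G. \<exists>k :: int. x = of_int k * g"
proof (cases "\<exists>x\<in>G. x \<noteq> 0")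
  case False
  then show ?thesis
    \<comment> \<open>Here \<open>G\<close> contains at most 0, so any number above
      \<open>\<rho>\<close> serves, with multiplier 0.\<close>
    by (intro exI[of _ "\<rho> + 1"]) (auto intro!: exI[of _ 0])
next
  case True
  then obtain y where y: "y \<in> G" "y \<noteq> 0" by blast
  have zero: "0 \<in> G" using diff[OF y(1) y(1)] by simp
  have neg: "- x \<in> G" if "x \<in> G" for x using diff[OF zero that] by simp
  have add: "x + z \<in> G" if "x \<in> G" "z \<in> G" for x z using diff[OF that(1) neg[OF that(2)]] by simp
  have mult_nat: "of_nat k * x \<in> G" if "x \<in> G" for x and k :: nat
    by (induction k) (auto simp: algebra_simps zero intro: add that)
  have mult: "of_int k * x \<in> G" if "x \<in> G" for x and k :: int
    using mult_nat[OF that] neg[OF mult_nat[OF that]] by (cases k rule: int_cases2) auto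
  define P where "P = {x\<in>G. x > 0}"
  have "\<bar>y\<bar> \<in> P" using y neg by (auto simp: P_def abs_if)
  then have ne: "P \<noteq> {}" by blast
  have gt: "x > \<rho>" if "x \<in> P" for x using large[of x] that by (auto simp: P_def)
  then have bdd: "bdd_below P" by (meson bdd_below.I less_imp_le)
  have step: "x = z" if "x \<in> P" "z \<in> P" "\<bar>x - z\<bar> < \<rho>" for x z
    using large[of "x - z"] that by (force simp: P_def intro: diff)
  define g where "g = Inf P"
  \<comment> \<open>An element within \<open>\<rho>\<close> of the infimum is already the minimum: a
    smaller positive element would lie between \<open>g\<close> and \<open>x\<close>, and
    \<open>step\<close> would identify the two.\<close>
  obtain x where x: "x \<in> P" "x < g + \<rho>"
    using cInf_less_iff[OF ne bdd, of "g + \<rho>"] \<rho> by (auto simp: g_def)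
  have le: "g \<le> z" if "z \<in> P" for z using that bdd by (auto simp: g_def intro: cInf_lower)
  have "x \<le> z" if z: "z \<in> P" for z
  proof (rule ccontr)
    assume "\<not> x \<le> z"
    then have "x = z" using le[OF z] x z by (intro step) auto
    then show False using \<open>\<not> x \<le> z\<close> by simp
  qed
  then have least: "x \<le> z" if "z \<in> P" for z using that by blast
  have xG: "x \<in> G" "x > 0" using x by (auto simp: P_def)
  have "z = of_int \<lfloor>z / x\<rfloor> * x" if z: "z \<in> G" for z
  proof -
    \<comment> \<open>The remainder of \<open>z\<close> modulo \<open>x\<close> lies in
      \<open>G\<close> and in the half-open interval from 0 to \<open>x\<close>, so minimality of
      \<open>x\<close> forces it to be 0.\<close>
    define w where "w = z - of_int \<lfloor>z / x\<rfloor> * x"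
    have "w \<in> G" unfolding w_def by (intro diff z mult xG)
    moreover have "w \<ge> 0" "w < x"
      using xG floor_divide_lower[of x z] floor_divide_upper[of x z] by (auto simp: w_def algebra_simps)
    ultimately have "w = 0" using least[of w] by (force simp: P_def)
    then show ?thesis by (simp add: w_def)
  qed
  then show ?thesis using gt[OF x(1)] by blast
qed

text \<open>The \<open>N\<close>-th root appears because a common generator \<open>g\<close> of the
  entries can be pulled out of all \<open>N\<close> rows, which contributes \<open>g ^ N\<close> to
  the determinant.\<close>

lemma small_combination_of_entries:
  fixes A :: "nat \<Rightarrow> nat \<Rightarrow> real"
  assumes N: "N > 0" and nz: "Determinant.det (Matrix.mat N N (\<lambda>(i, j). A i j)) \<noteq> 0" (is "?D \<noteq> 0")
  shows "\<exists>e :: nat \<Rightarrow> nat \<Rightarrow> int.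
    0 < \<bar>\<Sum>i<N. \<Sum>j<N. of_int (e i j) * A i j\<bar> \<and>
    \<bar>\<Sum>i<N. \<Sum>j<N. of_int (e i j) * A i j\<bar> \<le> root N \<bar>?D\<bar>"
proof (rule ccontr)
  assume *: "\<not> ?thesis"
  define comb :: "(nat \<Rightarrow> nat \<Rightarrow> int) \<Rightarrow> real"
    where "comb = (\<lambda>e. \<Sum>i<N. \<Sum>j<N. of_int (e i j) * A i j)"
  define \<rho> where "\<rho> = root N \<bar>?D\<bar>"
  have \<rho>: "\<rho> > 0" using N nz by (simp add: \<rho>_def)
  have "\<exists>g>\<rho>. \<forall>x\<in>range comb. \<exists>k :: int. x = of_int k * g"
  proof (rule cyclic_or_small_element[OF _ \<rho>])
    fix x y assume "x \<in> range comb" "y \<in> range comb"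
    then obtain e e' where "x = comb e" "y = comb e'" by blast
    then have "x - y = comb (\<lambda>i j. e i j - e' i j)"
      by (simp add: comb_def sum_subtractf left_diff_distrib)
    then show "x - y \<in> range comb" by blast
  next
    fix x assume "x \<in> range comb" "x \<noteq> 0"
    then show "\<bar>x\<bar> > \<rho>" using * by (force simp: comb_def \<rho>_def not_le)
  qed
  then obtain g where g: "g > \<rho>" "\<And>e. \<exists>k :: int. comb e = of_int k * g" by blast
  have entry: "\<exists>k :: int. A i j = of_int k * g" if "i < N" "j < N" for i j
  proof -
    \<comment> \<open>The coefficients form a matrix unit, so the combination is the single entry
      \<open>A i j\<close>; every entry is therefore an integer multiple of
      \<open>g\<close>.\<close>
    have "comb (\<lambda>i' j'. of_bool (i' = i) * of_bool (j' = j)) =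
        (\<Sum>i'<N. of_bool (i' = i) * (\<Sum>j'<N. of_bool (j' = j) * A i' j'))"
      by (simp add: comb_def sum_distrib_left mult.assoc del: sum_mult_of_bool_eq sum_of_bool_mult_eq)
    also have "\<dots> = A i j"
    proof -
      have "of_bool (k = l) * x = (if k = l then x else 0)" for k l :: nat and x :: real by simp
      then show ?thesis using that by (simp only: sum.delta finite_lessThan lessThan_iff if_True)
    qed
    finally show ?thesis using g(2) by metis
  qed
  then obtain k :: "nat \<Rightarrow> nat \<Rightarrow> int" where k: "\<And>i j. i < N \<Longrightarrow> j < N \<Longrightarrow> A i j = of_int (k i j) * g"
    by metis
  define K where "K = Matrix.mat N N (\<lambda>(i, j). k i j)"
  have "Matrix.mat N N (\<lambda>(i, j). A i j) = g \<cdot>\<^sub>m map_mat of_int K"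
    by (rule eq_matI) (auto simp: K_def k)
  then have D: "?D = g ^ N * of_int (Determinant.det K)"
    by (simp add: K_def)
  \<comment> \<open>The determinant of the integral matrix \<open>K\<close> is an integer, so being
    nonzero means having absolute value at least 1.\<close>
  with nz have "Determinant.det K \<noteq> 0" by auto
  then have "1 \<le> \<bar>real_of_int (Determinant.det K)\<bar>" by linarith
  then have "\<bar>g ^ N\<bar> \<le> \<bar>?D\<bar>"
    unfolding D abs_mult by (metis abs_ge_zero mult_left_mono mult.right_neutral)
  then have "root N (g ^ N) \<le> \<rho>"
    unfolding \<rho>_def using N by (intro real_root_le_mono) auto
  moreover have "root N (g ^ N) = g" using N g \<rho> by (intro real_root_power_cancel) auto
  ultimately show False using g by simp
qed

subsection \<open>Andreief's identity\<close>

lemma permutes_atLeast0LessThan_less: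
  fixes p :: "nat \<Rightarrow> nat"
  shows "p permutes {0..<n} \<Longrightarrow> i < n \<Longrightarrow> p i < n"
  using permutes_in_image[of p "{0..<n}" i] by auto

lemma det_mat_eq_sum:
  fixes f :: "nat \<Rightarrow> nat \<Rightarrow> 'a::comm_ring_1"
  shows "Determinant.det (Matrix.mat n n (\<lambda>(i, j). f i j)) =
    (\<Sum>p | p permutes {0..<n}. signof p * (\<Prod>i = 0..<n. f i (p i)))"
  by (subst det_def'[where n = n])
     (auto intro!: sum.cong prod.cong simp: permutes_atLeast0LessThan_less)

text \<open>Expanding both factors of the squared determinant by the Leibniz formula gives a double
  sum over permutations. Each term is a product of functions of one \<open>z i\<close> each, so by
  Fubini it integrates to a product of entries of \<open>?Q\<close>. The weight \<open>W\<close> is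
  complex because it will carry the pulled-back form.\<close>

lemma andreief:
  fixes F :: "nat \<Rightarrow> 'a \<Rightarrow> complex" and W :: "'a \<Rightarrow> complex"
  assumes sf: "sigma_finite_measure M"
    and int: "\<And>i j. i < N \<Longrightarrow> j < N \<Longrightarrow> integrable M (\<lambda>x. F i x * F j x * W x)"
  shows "integrable (Pi\<^sub>M {0..<N} (\<lambda>_. M))
      (\<lambda>z. (Determinant.det (Matrix.mat N N (\<lambda>(i, j). F j (z i))))\<^sup>2 * (\<Prod>i\<in>{0..<N}. W (z i)))"
      (is "integrable ?M ?g")
    and "fact N * Determinant.det (Matrix.mat N N (\<lambda>(i, j). \<integral>x. F i x * F j x * W x \<partial>M)) =
      (\<integral>z. (Determinant.det (Matrix.mat N N (\<lambda>(i, j). F j (z i))))\<^sup>2 * (\<Prod>i\<in>{0..<N}. W (z i)) \<partial>Pi\<^sub>M {0..<N} (\<lambda>_. M))"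
      (is "?fN * Determinant.det ?Q = _")
proof -
  interpret product_sigma_finite "\<lambda>_. M" using sf by (simp add: product_sigma_finite_def)
  let ?S = "{p. p permutes {0..<N}}"
  have fS: "finite ?S" by (simp add: finite_permutations)
  have less: "p i < N" if "p \<in> ?S" "i < N" for p i
    using that permutes_atLeast0LessThan_less by auto
  \<comment> \<open>\<open>h p q\<close> is the term of the expanded square belonging to the pair
    \<open>p\<close>, \<open>q\<close>, without its signs.\<close>
  define h where "h = (\<lambda>p q z. \<Prod>i\<in>{0..<N}. F (p i) (z i) * F (q i) (z i) * W (z i))"
  have inth: "integrable ?M (h p q)" if "p \<in> ?S" "q \<in> ?S" for p q
    unfolding h_def
    by (rule product_integrable_prod[where f = "\<lambda>i x. F (p i) x * F (q i) x * W x"])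
       (use that in \<open>simp_all add: int less\<close>)
  have valh: "(\<integral>z. h p q z \<partial>?M) = (\<Prod>i\<in>{0..<N}. ?Q $$ (p i, q i))" if "p \<in> ?S" "q \<in> ?S" for p q
    unfolding h_def
  proof (subst product_integral_prod[where f = "\<lambda>i x. F (p i) x * F (q i) x * W x"])
    show "(\<Prod>i\<in>{0..<N}. \<integral>x. F (p i) x * F (q i) x * W x \<partial>M) = (\<Prod>i\<in>{0..<N}. ?Q $$ (p i, q i))"
      by (rule prod.cong) (use that in \<open>simp_all add: less\<close>)
  qed (use that in \<open>simp_all add: int less\<close>)
  have expand: "?g z = (\<Sum>p\<in>?S. \<Sum>q\<in>?S. signof p * signof q * h p q z)" for z
  proof -
    have "Determinant.det (Matrix.mat N N (\<lambda>(i, j). F j (z i))) =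
        (\<Sum>p\<in>?S. signof p * (\<Prod>i = 0..<N. F (p i) (z i)))"
      by (rule det_mat_eq_sum)
    then have "?g z = (\<Sum>p\<in>?S. \<Sum>q\<in>?S. (signof p * (\<Prod>i = 0..<N. F (p i) (z i))) *
        (signof q * (\<Prod>i = 0..<N. F (q i) (z i))) * (\<Prod>i\<in>{0..<N}. W (z i)))"
      by (simp only: power2_eq_square sum_product) (simp only: sum_distrib_right)
    also have "\<dots> = (\<Sum>p\<in>?S. \<Sum>q\<in>?S. signof p * signof q * h p q z)"
      by (intro sum.cong refl) (simp add: h_def prod.distrib mult_ac)
    finally show ?thesis .
  qed
  have g: "?g = (\<lambda>z. \<Sum>p\<in>?S. \<Sum>q\<in>?S. signof p * signof q * h p q z)"
    using expand by (rule ext)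
  show "integrable ?M ?g"
    unfolding g by (intro Bochner_Integration.integrable_sum integrable_mult_right inth)
  have "(\<integral>z. ?g z \<partial>?M) = (\<Sum>p\<in>?S. \<Sum>q\<in>?S. signof p * signof q * (\<integral>z. h p q z \<partial>?M))"
    unfolding g
    by (subst Bochner_Integration.integral_sum)
       (auto simp: inth intro!: Bochner_Integration.integrable_sum sum.cong)
  also have "\<dots> = (\<Sum>p\<in>?S. signof p * (\<Sum>q\<in>?S. signof q * (\<Prod>i = 0..<N. ?Q $$ (p i, q i))))"
    by (simp add: valh sum_distrib_left mult.assoc del: index_mat)
  \<comment> \<open>The inner sum is the determinant of \<open>?Q\<close> with its rows permuted by \<open>p\<close>.\<close>
  also have "\<dots> = (\<Sum>p\<in>?S. signof p * (signof p * Determinant.det ?Q))"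
  proof (intro sum.cong refl arg_cong2[of _ _ _ _ "(*)"])
    fix p assume p: "p \<in> ?S"
    have "signof p * Determinant.det ?Q = Determinant.det (Matrix.mat N N (\<lambda>(i, j). ?Q $$ (p i, j)))"
      by (rule det_permute_rows[symmetric]) (use p in auto)
    also have "\<dots> = (\<Sum>q\<in>?S. signof q * (\<Prod>i = 0..<N. ?Q $$ (p i, q i)))"
      by (subst det_def'[where n = N]) (auto intro!: sum.cong prod.cong simp: less)
    finally show "(\<Sum>q\<in>?S. signof q * (\<Prod>i = 0..<N. ?Q $$ (p i, q i))) = signof p * Determinant.det ?Q" ..
  qed
  \<comment> \<open>The two equal signs cancel, and each of the \<open>N!\<close> permutations
    contributes one copy of the determinant.\<close>
  also have "\<dots> = (\<Sum>p\<in>?S. Determinant.det ?Q)"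
    by (intro sum.cong refl) (auto simp: sign_def)
  also have "\<dots> = ?fN * Determinant.det ?Q"
    by (simp add: card_permutations[of _ N])
  finally show "?fN * Determinant.det ?Q = (\<integral>z. ?g z \<partial>?M)" ..
qed

text \<open>The determinant has to be bounded only at tuples where no weight vanishes, since
  elsewhere the integrand of Andreief's identity is 0. This lets \<open>t\<close> be a supremum over
  the support of the chain alone.\<close>

lemma andreief_bound:
  fixes F :: "nat \<Rightarrow> 'a \<Rightarrow> complex" and W :: "'a \<Rightarrow> complex"
  assumes sf: "sigma_finite_measure M" and W: "integrable M W"
    and int: "\<And>i j. i < N \<Longrightarrow> j < N \<Longrightarrow> integrable M (\<lambda>x. F i x * F j x * W x)"
    and bound: "\<And>z. (\<And>i. i < N \<Longrightarrow> z i \<in> space M \<and> W (z i) \<noteq> 0) \<Longrightarrow>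
      cmod (Determinant.det (Matrix.mat N N (\<lambda>(i, j). F j (z i)))) \<le> t"
  shows "fact N * cmod (Determinant.det (Matrix.mat N N (\<lambda>(i, j). \<integral>x. F i x * F j x * W x \<partial>M)))
    \<le> t\<^sup>2 * (\<integral>x. cmod (W x) \<partial>M) ^ N"
    (is "_ * cmod ?D \<le> _")
proof -
  interpret product_sigma_finite "\<lambda>_. M" using sf by (simp add: product_sigma_finite_def)
  let ?M = "Pi\<^sub>M {0..<N} (\<lambda>_. M)"
  let ?g = "\<lambda>z. (Determinant.det (Matrix.mat N N (\<lambda>(i, j). F j (z i))))\<^sup>2 * (\<Prod>i\<in>{0..<N}. W (z i))"
  let ?b = "\<lambda>z. t\<^sup>2 * (\<Prod>i\<in>{0..<N}. cmod (W (z i)))"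
  note A = andreief[OF sf, where N = N and F = F and W = W, OF int]
  have "fact N * cmod ?D = cmod (fact N * ?D)" by (simp add: norm_mult)
  also have "\<dots> = cmod (\<integral>z. ?g z \<partial>?M)" using A(2) by simp
  also have "\<dots> \<le> (\<integral>z. cmod (?g z) \<partial>?M)" by (rule integral_norm_bound)
  also have "\<dots> \<le> (\<integral>z. ?b z \<partial>?M)"
  proof (rule integral_mono)
    show "integrable ?M (\<lambda>z. cmod (?g z))" using A(1) by (rule integrable_norm)
    show "integrable ?M ?b"
      by (intro integrable_mult_right product_integrable_prod integrable_norm W) auto
    fix z assume z: "z \<in> space ?M"
    show "cmod (?g z) \<le> ?b z"
    proof (cases "\<forall>i<N. W (z i) \<noteq> 0")
      case True
      have "z i \<in> space M" if "i < N" for i using z that by (auto simp: space_PiM)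
      then have "cmod (Determinant.det (Matrix.mat N N (\<lambda>(i, j). F j (z i)))) \<le> t"
        using True by (intro bound) auto
      then have "(cmod (Determinant.det (Matrix.mat N N (\<lambda>(i, j). F j (z i)))))\<^sup>2 \<le> t\<^sup>2"
        by (intro power_mono) auto
      then show ?thesis
        by (simp add: norm_mult norm_power prod_norm[symmetric] mult_right_mono prod_nonneg)
    next
      case False
      then obtain i where i: "i \<in> {0..<N}" "W (z i) = 0" by auto
      then have "(\<Prod>i\<in>{0..<N}. W (z i)) = 0" by (intro prod_zero) auto
      then have "?g z = 0" by (simp only: mult_zero_right)
      then show ?thesis by (simp only: norm_zero) (simp add: prod_nonneg)
    qed
  qed
  \<comment> \<open>The majorant is a product over the coordinates, so its integral is a power of a
    single integral.\<close>
  also have "\<dots> = t\<^sup>2 * (\<integral>x. cmod (W x) \<partial>M) ^ N"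
    by (simp add: product_integral_prod[where f = "\<lambda>_ x. cmod (W x)"] W)
  finally show ?thesis .
qed

subsection \<open>Integration over smooth chains\<close>

lemma continuous_on_coordinate: "continuous_on S (\<lambda>x. (x :: 'a \<Rightarrow> 'b::topological_space) i)"
  by (rule continuous_on_subset[OF continuous_on_product_coordinates]) simp

lemma continuous_on_poly_eval: "continuous_on S (poly_eval \<iota> p)"
  unfolding poly_eval_def by (intro continuous_intros continuous_on_coordinate)

lemma continuous_on_det:
  fixes f :: "'a::topological_space \<Rightarrow> nat \<Rightarrow> nat \<Rightarrow> 'b::{real_normed_algebra_1, comm_ring_1}"
  assumes "\<And>i j. i < n \<Longrightarrow> j < n \<Longrightarrow> continuous_on S (\<lambda>x. f x i j)"
  shows "continuous_on S (\<lambda>x. Determinant.det (Matrix.mat n n (\<lambda>(i, j). f x i j)))"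
  unfolding det_mat_eq_sum
  by (intro continuous_on_sum continuous_on_mult continuous_on_const continuous_on_prod assms)
     (simp_all add: permutes_atLeast0LessThan_less)

lemma regular_function_continuous: "regular_function n X h \<Longrightarrow> continuous_on X h"
  unfolding regular_function_def
  using continuous_on_poly_eval by (metis continuous_on_cong)

lemma closed_closed_corner: "closed (closed_corner d)"
  unfolding closed_corner_def
  by (intro closed_Collect_conj closed_Collect_all closed_Collect_imp closed_Collect_le
      continuous_intros continuous_on_coordinate) auto

lemma open_open_corner: "open (open_corner d)"
proof -
  have "open_corner d = (\<Inter>j<d. {t. 0 < t j}) \<inter> {t. (\<Sum>j<d. t j) < 1}"
    by (auto simp: open_corner_def)
  then show ?thesis
    by (auto intro!: open_INT open_Int open_Collect_less continuous_intros continuous_on_coordinate)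
qed

lemma open_corner_subset: "open_corner d \<subseteq> closed_corner d"
  by (auto simp: open_corner_def closed_corner_def less_imp_le)

lemma closed_corner_le_one: "t \<in> closed_corner d \<Longrightarrow> j < d \<Longrightarrow> t j \<le> 1"
  unfolding closed_corner_def
  using member_le_sum[of j "{..<d}" t] by auto

text \<open>Continuity yields Borel measurability on the space of all real sequences; composing with
  the identity transfers it to the finite product measure.\<close>

lemma measurable_PiM_ident: "(\<lambda>t :: nat \<Rightarrow> real. t) \<in> borel_measurable (Pi\<^sub>M {..<d} (\<lambda>_. lborel))"
proof (rule measurable_coordinatewise_then_product)
  fix i
  show "(\<lambda>t :: nat \<Rightarrow> real. t i) \<in> borel_measurable (Pi\<^sub>M {..<d} (\<lambda>_. lborel))"
  proof (cases "i < d")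
    case False
    \<comment> \<open>Points of the product space are extensional, so the coordinates from
      \<open>d\<close> on are constant.\<close>
    then have "\<forall>t\<in>space (Pi\<^sub>M {..<d} (\<lambda>_. lborel :: real measure)). t i = undefined"
      by (auto simp: space_PiM PiE_def extensional_def)
    then show ?thesis
      by (subst Sigma_Algebra.measurable_cong[where g = "\<lambda>_. undefined"]) simp_all
  qed simp
qed

text \<open>The values of \<open>\<phi>\<close> on the faces are uncontrolled. Boundedness is
  therefore taken from \<open>\<psi>\<close> on the closed corner, and measurability from continuity
  of \<open>\<phi>\<close> on the open one.\<close>

lemma set_integrable_open_corner:
  fixes \<phi> \<psi> :: "(nat \<Rightarrow> real) \<Rightarrow> complex"
  assumes cont: "continuous_on (closed_corner d) \<psi>"
    and eq: "\<And>t. t \<in> open_corner d \<Longrightarrow> \<phi> t = \<psi> t"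
  shows "set_integrable (Pi\<^sub>M {..<d} (\<lambda>_. lborel)) (open_corner d) \<phi>"
proof -
  let ?P = "Pi\<^sub>M {..<d} (\<lambda>_. lborel :: real measure)"
  interpret product_sigma_finite "\<lambda>_ :: nat. lborel :: real measure" by unfold_locales
  \<comment> \<open>The corners are cylinders, but the points of the product measure space are
    \<open>undefined\<close> from index \<open>d\<close> on, so only a compact part of the closed corner matters.\<close>
  define S :: "nat \<Rightarrow> real set" where "S = (\<lambda>i. if i < d then {0..1} else {undefined})"
  have "compactin euclidean (Pi\<^sub>E UNIV S)"
    unfolding euclidean_product_topology[symmetric] by (subst compactin_PiE) (auto simp: S_def)
  then have "compact (Pi\<^sub>E UNIV S)" by simp
  then have "compact (Pi\<^sub>E UNIV S \<inter> closed_corner d)"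
    using closed_closed_corner by (rule compact_Int_closed)
  then have "compact (\<psi> ` (Pi\<^sub>E UNIV S \<inter> closed_corner d))"
    by (rule compact_continuous_image[rotated]) (rule continuous_on_subset[OF cont], auto)
  then obtain B where B: "\<And>t. t \<in> Pi\<^sub>E UNIV S \<inter> closed_corner d \<Longrightarrow> cmod (\<psi> t) \<le> B"
    by (meson bounded_iff compact_imp_bounded imageI)
  have inS: "t \<in> Pi\<^sub>E UNIV S \<inter> closed_corner d" if "t \<in> space ?P" "t \<in> open_corner d" for t
    using that open_corner_subset[of d] closed_corner_le_one[of t d]
    by (auto simp: S_def space_PiM PiE_def extensional_def closed_corner_def open_corner_def)
  \<comment> \<open>The unit cube, a set of measure 1 outside which the integrand vanishes.\<close>
  define A where "A = Pi\<^sub>E {..<d} (\<lambda>_. {0..1 :: real})"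
  have "continuous_on (open_corner d) \<phi>"
    using continuous_on_subset[OF cont open_corner_subset] eq by (simp cong: continuous_on_cong)
  then have "(\<lambda>t. indicator (open_corner d) t *\<^sub>R \<phi> t) \<in> borel_measurable borel"
    by (intro borel_measurable_continuous_on_indicator) (use open_open_corner in auto)
  then have meas: "(\<lambda>t. indicator (open_corner d) t *\<^sub>R \<phi> t) \<in> borel_measurable ?P"
    by (rule measurable_compose[OF measurable_PiM_ident])
  have "integrable ?P (\<lambda>t. indicator (open_corner d) t *\<^sub>R \<phi> t)"
  proof (rule integrableI_bounded_set)
    show "A \<in> sets ?P" unfolding A_def by (rule sets_PiM_I_finite) auto
    have "emeasure ?P A = 1" unfolding A_def by (subst emeasure_PiM) auto
    then show "emeasure ?P A < \<infinity>" by simp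
    \<comment> \<open>The integrand is 0 on the part of the cube outside the open corner, and
      nothing is recorded about the sign of \<open>B\<close>; hence \<open>max 0 B\<close>.\<close>
    show "AE t in ?P. t \<in> A \<longrightarrow> norm (indicator (open_corner d) t *\<^sub>R \<phi> t) \<le> max 0 B"
      using B[OF inS] eq by (intro AE_I2) (auto simp: indicator_def le_max_iff_disj)
    show "AE t in ?P. t \<notin> A \<longrightarrow> indicator (open_corner d) t *\<^sub>R \<phi> t = 0"
    proof (intro AE_I2 impI)
      fix t assume "t \<in> space ?P" "t \<notin> A"
      then have "t \<notin> open_corner d"
        using inS[of t] by (auto simp: A_def S_def space_PiM PiE_def Pi_def split: if_splits)
      then show "indicator (open_corner d) t *\<^sub>R \<phi> t = 0" by simp
    qed
  qed (rule meas)
  then show ?thesis unfolding set_integrable_def .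
qed

lemma continuous_on_barycentric: "continuous_on S (barycentric d)"
proof (rule continuous_on_coordinatewise_then_product)
  fix i
  consider "i = 0" | "i \<noteq> 0" "i \<le> d" | "i > d" by linarith
  then show "continuous_on S (\<lambda>t. barycentric d t i)"
    by cases (auto simp: barycentric_def intro!: continuous_intros continuous_on_coordinate)
qed

lemma barycentric_in_standard_simplex:
  assumes t: "t \<in> closed_corner d"
  shows "barycentric d t \<in> standard_simplex d"
proof -
  have "(\<Sum>i\<le>d. barycentric d t i) = 1"
    by (subst sum.atMost_shift) (simp add: barycentric_def)
  moreover have "0 \<le> barycentric d t i \<and> barycentric d t i \<le> 1" for i
  proof (cases "0 < i \<and> i \<le> d")
    case True
    then have "i - 1 < d" by auto
    then show ?thesis
      using True t closed_corner_le_one[OF t] by (auto simp: barycentric_def closed_corner_def)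
  next
    case False
    then show ?thesis
      using t by (auto simp: barycentric_def closed_corner_def intro: sum_nonneg)
  qed
  ultimately show ?thesis by (auto simp: standard_simplex_def barycentric_def)
qed

lemma singular_simplex_barycentric:
  assumes "singular_simplex d (top_of_set X) s"
  shows "continuous_on (closed_corner d) (\<lambda>t. s (barycentric d t))"
    and "t \<in> closed_corner d \<Longrightarrow> s (barycentric d t) \<in> X"
proof -
  have s: "continuous_on (standard_simplex d) s" "s \<in> standard_simplex d \<rightarrow> X"
    using assms by (auto simp: singular_simplex_def euclidean_product_topology continuous_map_in_subtopology)
  show "continuous_on (closed_corner d) (\<lambda>t. s (barycentric d t))"
    by (rule continuous_on_compose2[OF s(1) continuous_on_barycentric])
       (auto intro: barycentric_in_standard_simplex)
  show "s (barycentric d t) \<in> X" if "t \<in> closed_corner d"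
    using s(2) barycentric_in_standard_simplex[OF that] by auto
qed

section \<open>Pullback of differential forms along \<open>C1\<close> simplices\<close>

definition pullback_density ::
  "nat \<Rightarrow> nat \<Rightarrow> ((nat \<Rightarrow> real) \<Rightarrow> cpoint) \<Rightarrow> diff_form \<Rightarrow> (nat \<Rightarrow> real) \<Rightarrow> complex" where
  "pullback_density n d s \<omega> t =
     (\<Sum>I\<in>form_indices n d. \<omega> I (s (barycentric d t)) *
        Determinant.det (Matrix.mat d d (\<lambda>(k, j).
          vector_derivative (\<lambda>u. s (barycentric d (t(j := u))) (sorted_list_of_set I ! k))
            (at (t j)))))"

lemma simplex_integral_eq:
  "simplex_integral n d s \<omega> =
     set_lebesgue_integral (Pi\<^sub>M {..<d} (\<lambda>_. lborel)) (open_corner d) (pullback_density n d s \<omega>)"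
  unfolding simplex_integral_def pullback_density_def ..

lemma pullback_density_scale_form:
  "pullback_density n d s (scale_form h \<omega>) t = h (s (barycentric d t)) * pullback_density n d s \<omega> t"
  by (simp add: pullback_density_def scale_form_def sum_distrib_left mult.assoc)

text \<open>The extension \<open>g\<close> agrees with the simplex near each point of the open
  corner, so both have the same partial derivatives there. Those of \<open>g\<close> stay continuous
  up to the faces, where two-sided derivatives of the simplex need not exist.\<close>

lemma C1_simplex_derivative:
  assumes "C1_simplex n d s"
  obtains D where "\<And>i j. i < n \<Longrightarrow> j < d \<Longrightarrow> continuous_on (closed_corner d) (D i j)"
    and "\<And>i j t. i < n \<Longrightarrow> j < d \<Longrightarrow> t \<in> open_corner d \<Longrightarrow>
      vector_derivative (\<lambda>u. s (barycentric d (t(j := u))) i) (at (t j)) = D i j t"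
proof -
  obtain U g where U: "open U" "closed_corner d \<subseteq> U"
    and g: "\<And>t i. t \<in> closed_corner d \<Longrightarrow> i < n \<Longrightarrow> g t i = s (barycentric d t) i"
    and "\<forall>i<n. \<forall>j<d. \<exists>g'. continuous_on U g' \<and>
           (\<forall>t\<in>U. ((\<lambda>u. g (t(j := u)) i) has_vector_derivative g' t) (at (t j)))"
    using assms unfolding C1_simplex_def by blast
  then obtain D where D: "\<And>i j. i < n \<Longrightarrow> j < d \<Longrightarrow> continuous_on U (D i j)"
    "\<And>i j t. i < n \<Longrightarrow> j < d \<Longrightarrow> t \<in> U \<Longrightarrow>
      ((\<lambda>u. g (t(j := u)) i) has_vector_derivative D i j t) (at (t j))"
    by metis
  show ?thesis
  proof (rule that)
    show "continuous_on (closed_corner d) (D i j)" if "i < n" "j < d" for i j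
      using D(1)[OF that] U(2) by (rule continuous_on_subset)
    fix i j t assume ij: "i < n" "j < d" and t: "t \<in> open_corner d"
    \<comment> \<open>The parameters that keep the point in the open corner form an open set;
      agreement of the two curves on it gives equal derivatives.\<close>
    let ?V = "(\<lambda>u. t(j := u)) -` open_corner d"
    have "continuous_on UNIV (\<lambda>u. (t(j := u)) i)" for i by (cases "i = j") auto
    then have "continuous_on UNIV (\<lambda>u. t(j := u))"
      by (rule continuous_on_coordinatewise_then_product)
    then have V: "open ?V" using open_open_corner by (auto intro: open_vimage)
    have "((\<lambda>u. s (barycentric d (t(j := u))) i) has_vector_derivative D i j t) (at (t j))"
    proof (rule has_vector_derivative_transform_within_open[OF _ V])
      show "((\<lambda>u. g (t(j := u)) i) has_vector_derivative D i j t) (at (t j))"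
        using ij t U(2) open_corner_subset by (intro D(2)) auto
    qed (use t ij g open_corner_subset in auto)
    then show "vector_derivative (\<lambda>u. s (barycentric d (t(j := u))) i) (at (t j)) = D i j t"
      by (rule vector_derivative_at)
  qed
qed

text \<open>Replacing the derivatives by their continuous extensions \<open>D\<close> gives an
  integrand that is continuous on the closed corner and equal to the original on the open
  one.\<close>

lemma set_integrable_pullback_density:
  assumes s: "singular_simplex d (top_of_set X) s" "C1_simplex n d s"
    and \<omega>: "regular_form n d X \<omega>" and h: "continuous_on X h"
  shows "set_integrable (Pi\<^sub>M {..<d} (\<lambda>_. lborel)) (open_corner d)
    (\<lambda>t. h (s (barycentric d t)) * pullback_density n d s \<omega> t)"
proof -
  note sX = singular_simplex_barycentric[OF s(1)]
  obtain D where D: "\<And>i j. i < n \<Longrightarrow> j < d \<Longrightarrow> continuous_on (closed_corner d) (D i j)"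
    "\<And>i j t. i < n \<Longrightarrow> j < d \<Longrightarrow> t \<in> open_corner d \<Longrightarrow>
      vector_derivative (\<lambda>u. s (barycentric d (t(j := u))) i) (at (t j)) = D i j t"
    using C1_simplex_derivative[OF s(2)] by blast
  have index: "sorted_list_of_set I ! k < n" if "I \<in> form_indices n d" "k < d" for I k
  proof -
    have I: "I \<subseteq> {..<n}" "card I = d" "finite I"
      using that finite_subset by (auto simp: form_indices_def)
    then have "sorted_list_of_set I ! k \<in> set (sorted_list_of_set I)"
      using that by (intro nth_mem) simp
    then show ?thesis using I by auto
  qed
  let ?J = "\<lambda>I t. Determinant.det (Matrix.mat d d (\<lambda>(k, j). D (sorted_list_of_set I ! k) j t))"
  show ?thesis
  proof (rule set_integrable_open_corner)
    have comp: "continuous_on (closed_corner d) (\<lambda>t. k (s (barycentric d t)))"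
      if "continuous_on X k" for k :: "cpoint \<Rightarrow> complex"
      by (rule continuous_on_compose2[OF that sX(1)]) (auto intro: sX(2))
    have reg: "continuous_on X (\<omega> I)" if "I \<in> form_indices n d" for I
      using \<omega> that by (auto simp: regular_form_def intro: regular_function_continuous)
    have "continuous_on (closed_corner d) (?J I)" if "I \<in> form_indices n d" for I
      by (rule continuous_on_det) (auto intro!: D(1) index that)
    then show "continuous_on (closed_corner d)
        (\<lambda>t. h (s (barycentric d t)) *
          (\<Sum>I\<in>form_indices n d. \<omega> I (s (barycentric d t)) * ?J I t))"
      by (intro continuous_on_mult continuous_on_sum comp h reg) auto
    fix t assume t: "t \<in> open_corner d"
    have "Matrix.mat d d (\<lambda>(k, j).
          vector_derivative (\<lambda>u. s (barycentric d (t(j := u))) (sorted_list_of_set I ! k)) (at (t j))) =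
        Matrix.mat d d (\<lambda>(k, j). D (sorted_list_of_set I ! k) j t)"
      if "I \<in> form_indices n d" for I
      by (rule eq_matI) (auto simp: D(2) index that t)
    then show "h (s (barycentric d t)) * pullback_density n d s \<omega> t =
        h (s (barycentric d t)) * (\<Sum>I\<in>form_indices n d. \<omega> I (s (barycentric d t)) * ?J I t)"
      unfolding pullback_density_def by (simp cong: sum.cong)
  qed
qed

section \<open>The chain as a single measure space\<close>

lemma
  fixes g :: "'a \<times> 'b \<Rightarrow> 'c::{banach, second_countable_topology}"
  assumes S: "finite S" and P: "sigma_finite_measure P"
    and g: "\<And>s. s \<in> S \<Longrightarrow> integrable P (\<lambda>t. g (s, t))"
  shows integrable_count_space_pair: "integrable (count_space S \<Otimes>\<^sub>M P) g"
    and integral_count_space_pair: "integral\<^sup>L (count_space S \<Otimes>\<^sub>M P) g = (\<Sum>s\<in>S. \<integral>t. g (s, t) \<partial>P)"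
proof -
  interpret P: sigma_finite_measure P by fact
  interpret C: sigma_finite_measure "count_space S"
    by (rule sigma_finite_measure_count_space_finite[OF S])
  interpret pair_sigma_finite "count_space S" P ..
  show int: "integrable (count_space S \<Otimes>\<^sub>M P) g"
  proof (rule Fubini_integrable)
    show "g \<in> borel_measurable (count_space S \<Otimes>\<^sub>M P)"
      by (rule measurable_pair_measure_countable1)
         (use S g in \<open>auto intro: countable_finite borel_measurable_integrable\<close>)
    show "integrable (count_space S) (\<lambda>s. \<integral>t. norm (g (s, t)) \<partial>P)"
      using S by (rule integrable_count_space)
    show "AE s in count_space S. integrable P (\<lambda>t. g (s, t))"
      using g by (auto simp: AE_count_space)
  qed
  show "integral\<^sup>L (count_space S \<Otimes>\<^sub>M P) g = (\<Sum>s\<in>S. \<integral>t. g (s, t) \<partial>P)"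
    using integral_fst'[OF int] S by (simp add: lebesgue_integral_count_space_finite)
qed

text \<open>The parameter domains of all simplices are laid side by side, so that a chain integral
  becomes one integral over a sigma-finite space, the form in which Andreief's identity
  applies.\<close>

definition chain_measure :: "nat \<Rightarrow> cpoint chain \<Rightarrow> (((nat \<Rightarrow> real) \<Rightarrow> cpoint) \<times> (nat \<Rightarrow> real)) measure" where
  "chain_measure d \<sigma> = count_space (Poly_Mapping.keys \<sigma>) \<Otimes>\<^sub>M Pi\<^sub>M {..<d} (\<lambda>_. lborel)"

text \<open>The multiplicities, possibly negative, go into the complex density, so that the
  underlying measure stays positive.\<close>

definition chain_density ::
  "nat \<Rightarrow> nat \<Rightarrow> cpoint chain \<Rightarrow> diff_form \<Rightarrow> ((nat \<Rightarrow> real) \<Rightarrow> cpoint) \<times> (nat \<Rightarrow> real) \<Rightarrow> complex" where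
  "chain_density n d \<sigma> \<omega> = (\<lambda>(s, t). of_int (Poly_Mapping.lookup \<sigma> s) *
     (indicator (open_corner d) t *\<^sub>R pullback_density n d s \<omega> t))"

definition chain_point :: "nat \<Rightarrow> ((nat \<Rightarrow> real) \<Rightarrow> cpoint) \<times> (nat \<Rightarrow> real) \<Rightarrow> cpoint" where
  "chain_point d = (\<lambda>(s, t). s (barycentric d t))"

lemma sigma_finite_lborel_PiM: "sigma_finite_measure (Pi\<^sub>M {..<d :: nat} (\<lambda>_. lborel :: real measure))"
proof -
  interpret product_sigma_finite "\<lambda>_ :: nat. lborel :: real measure" by unfold_locales
  show ?thesis by (rule sigma_finite) simp
qed

lemma sigma_finite_chain_measure: "sigma_finite_measure (chain_measure d \<sigma>)"
proof -
  interpret P: sigma_finite_measure "Pi\<^sub>M {..<d :: nat} (\<lambda>_. lborel :: real measure)"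
    by (rule sigma_finite_lborel_PiM)
  interpret C: sigma_finite_measure "count_space (Poly_Mapping.keys \<sigma>)"
    by (rule sigma_finite_measure_count_space_finite) simp
  interpret pair_sigma_finite "count_space (Poly_Mapping.keys \<sigma>)" "Pi\<^sub>M {..<d :: nat} (\<lambda>_. lborel :: real measure)" ..
  show ?thesis unfolding chain_measure_def by unfold_locales
qed

text \<open>The factor \<open>h\<close> is an arbitrary continuous function on \<open>X\<close>,
  which covers Mellin monomials and products of two pulled-back polynomials alike. There are
  finitely many simplices, and each contributes an integrable piece.\<close>

lemma
  assumes \<sigma>: "relative_chain n d X Y \<sigma>" and \<omega>: "regular_form n d X \<omega>" and h: "continuous_on X h"
  shows integrable_chain_density:
      "integrable (chain_measure d \<sigma>) (\<lambda>x. h (chain_point d x) * chain_density n d \<sigma> \<omega> x)"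
    and chain_integral_eq: "chain_integral n d \<sigma> (scale_form h \<omega>) =
      (\<integral>x. h (chain_point d x) * chain_density n d \<sigma> \<omega> x \<partial>chain_measure d \<sigma>)"
proof -
  let ?P = "Pi\<^sub>M {..<d} (\<lambda>_. lborel :: real measure)"
  let ?g = "\<lambda>s t. indicator (open_corner d) t *\<^sub>R (h (s (barycentric d t)) * pullback_density n d s \<omega> t)"
  have s: "singular_simplex d (top_of_set X) s" "C1_simplex n d s" if "s \<in> Poly_Mapping.keys \<sigma>" for s
    using \<sigma> that by (auto simp: relative_chain_def singular_relcycle_def singular_chain_def)
  have split: "h (chain_point d (s, t)) * chain_density n d \<sigma> \<omega> (s, t) =
      of_int (Poly_Mapping.lookup \<sigma> s) * ?g s t" for s t
    by (simp add: chain_point_def chain_density_def)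
  have int: "integrable ?P (?g s)" if "s \<in> Poly_Mapping.keys \<sigma>" for s
    using set_integrable_pullback_density[OF s[OF that] \<omega> h] unfolding set_integrable_def .
  have int': "integrable ?P (\<lambda>t. h (chain_point d (s, t)) * chain_density n d \<sigma> \<omega> (s, t))"
    if "s \<in> Poly_Mapping.keys \<sigma>" for s
    unfolding split using int[OF that] by (rule integrable_mult_right)
  show "integrable (chain_measure d \<sigma>) (\<lambda>x. h (chain_point d x) * chain_density n d \<sigma> \<omega> x)"
    unfolding chain_measure_def
    by (rule integrable_count_space_pair[OF _ sigma_finite_lborel_PiM]) (auto intro: int')
  have "(\<integral>x. h (chain_point d x) * chain_density n d \<sigma> \<omega> x \<partial>chain_measure d \<sigma>) =
      (\<Sum>s\<in>Poly_Mapping.keys \<sigma>. \<integral>t. of_int (Poly_Mapping.lookup \<sigma> s) * ?g s t \<partial>?P)"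
    unfolding chain_measure_def split[symmetric]
    by (rule integral_count_space_pair[OF _ sigma_finite_lborel_PiM]) (auto intro: int')
  also have "\<dots> = (\<Sum>s\<in>Poly_Mapping.keys \<sigma>. of_int (Poly_Mapping.lookup \<sigma> s) * (\<integral>t. ?g s t \<partial>?P))"
    by (simp only: integral_mult_right_zero)
  also have "\<dots> = chain_integral n d \<sigma> (scale_form h \<omega>)"
    unfolding chain_integral_def simplex_integral_eq set_lebesgue_integral_def pullback_density_scale_form ..
  finally show "chain_integral n d \<sigma> (scale_form h \<omega>) =
      (\<integral>x. h (chain_point d x) * chain_density n d \<sigma> \<omega> x \<partial>chain_measure d \<sigma>)" ..
qed

section \<open>Finiteness of the supremum of determinants\<close>

lemma norm_det_le:
  fixes A :: "nat \<Rightarrow> nat \<Rightarrow> complex"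
  assumes "\<And>i j. i < N \<Longrightarrow> j < N \<Longrightarrow> cmod (A i j) \<le> B"
  shows "cmod (Determinant.det (Matrix.mat N N (\<lambda>(i, j). A i j))) \<le> fact N * B ^ N"
proof -
  have "Determinant.det (Matrix.mat N N (\<lambda>(i, j). A i j)) =
      (\<Sum>p | p permutes {0..<N}. signof p * (\<Prod>i = 0..<N. A i (p i)))"
    by (rule det_mat_eq_sum)
  also have "cmod \<dots> \<le> (\<Sum>p | p permutes {0..<N}. B ^ N)"
  proof (rule sum_norm_le)
    fix p assume p: "p \<in> {p. p permutes {0..<N}}"
    have "cmod (signof p * (\<Prod>i = 0..<N. A i (p i))) = (\<Prod>i = 0..<N. cmod (A i (p i)))"
      by (simp add: norm_mult prod_norm sign_def)
    also have "\<dots> \<le> (\<Prod>i = 0..<N. B)"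
      using p by (intro prod_mono) (auto intro!: assms simp: permutes_atLeast0LessThan_less)
    finally show "cmod (signof p * (\<Prod>i = 0..<N. A i (p i))) \<le> B ^ N" by simp
  qed
  also have "\<dots> = fact N * B ^ N"
    by (simp add: card_permutations[of _ N])
  finally show ?thesis .
qed

text \<open>\<open>Sup\<close> on the reals is an upper bound only for sets bounded above.
  Compactness of \<open>\<tau>\<close> bounds the entries, and \<open>norm_det_le\<close> then
  bounds the determinants.\<close>

lemma det_le_sup_det:
  assumes \<tau>: "compact \<tau>" and z: "\<And>i. i < N \<Longrightarrow> z i \<in> \<tau>"
  shows "cmod (Determinant.det (Matrix.mat N N (\<lambda>(i, j). poly_eval of_int (m j) (z i))))
    \<le> sup_det N m \<tau>"
  unfolding sup_det_def
proof (rule cSup_upper)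
  have "\<exists>B. \<forall>x\<in>\<tau>. cmod (poly_eval of_int (m j) x) \<le> B" for j
    using compact_imp_bounded[OF compact_continuous_image[OF continuous_on_poly_eval \<tau>], of of_int "m j"]
    by (auto simp: bounded_iff)
  then obtain B where B: "\<And>j x. x \<in> \<tau> \<Longrightarrow> cmod (poly_eval of_int (m j) x) \<le> B j" by metis
  \<comment> \<open>Summing the moduli bounds all \<open>N\<close> polynomials by one constant, as
    \<open>norm_det_le\<close> requires.\<close>
  have "cmod (poly_eval of_int (m j) x) \<le> (\<Sum>j<N. \<bar>B j\<bar>)" if "j < N" "x \<in> \<tau>" for j x
    using B[OF that(2), of j] member_le_sum[of j "{..<N}" "\<lambda>j. \<bar>B j\<bar>"] that(1) by force
  then show "bdd_above {cmod (Determinant.det (Matrix.mat N N (\<lambda>(i, j). poly_eval of_int (m j) (z i)))) | z.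
      \<forall>i<N. z i \<in> \<tau>}"
    by (intro bdd_aboveI[of _ "fact N * (\<Sum>j<N. \<bar>B j\<bar>) ^ N"]) (auto intro!: norm_det_le)
qed (use z in blast)

subsection \<open>Mellin integrals and the matrix of the quadratic form\<close>

lemma morphism_continuous:
  assumes "morphism_to_affine_space n X r f"
  shows "continuous_on X f"
proof (rule continuous_on_coordinatewise_then_product)
  fix i
  show "continuous_on X (\<lambda>x. f x i)"
  proof (cases "i < r")
    case True
    then show ?thesis
      using assms by (auto simp: morphism_to_affine_space_def intro: regular_function_continuous)
  next
    case False
    then have "f x i = 0" if "x \<in> X" for x
      using assms that by (auto simp: morphism_to_affine_space_def affine_space_def)
    then show ?thesis by (simp cong: continuous_on_cong)
  qed
qed

lemma relative_chain_simplex: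
  assumes "relative_chain n d X Y \<sigma>" "s \<in> Poly_Mapping.keys \<sigma>"
  shows "continuous_on (standard_simplex d) s" and "s ` standard_simplex d \<subseteq> X"
proof -
  have "singular_simplex d (top_of_set X) s"
    using assms by (auto simp: relative_chain_def singular_relcycle_def singular_chain_def)
  then have "continuous_on (standard_simplex d) s" "s \<in> standard_simplex d \<rightarrow> X"
    by (auto simp: singular_simplex_def euclidean_product_topology continuous_map_in_subtopology)
  then show "continuous_on (standard_simplex d) s" and "s ` standard_simplex d \<subseteq> X" by auto
qed

lemma compact_chain_support:
  assumes "relative_chain n d X Y \<sigma>"
  shows "compact (chain_support d \<sigma>)" and "chain_support d \<sigma> \<subseteq> X"
proof -
  have "compact (standard_simplex d)"
    using compactin_standard_simplex[of d] by (simp add: euclidean_product_topology)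
  then show "compact (chain_support d \<sigma>)"
    unfolding chain_support_def
    by (intro compact_UN compact_continuous_image relative_chain_simplex[OF assms]) auto
  show "chain_support d \<sigma> \<subseteq> X"
    using relative_chain_simplex(2)[OF assms] by (auto simp: chain_support_def)
qed

text \<open>Links the nonvanishing weights in \<open>andreief_bound\<close> to points of the compact
  support, over which the supremum is taken.\<close>

lemma chain_point_in_support:
  assumes "x \<in> space (chain_measure d \<sigma>)" "chain_density n d \<sigma> \<omega> x \<noteq> 0"
  shows "chain_point d x \<in> chain_support d \<sigma>"
proof -
  obtain s t where x: "x = (s, t)" by (cases x)
  have "s \<in> Poly_Mapping.keys \<sigma>"
    using assms(1) by (simp add: x chain_measure_def space_pair_measure)
  moreover have "t \<in> open_corner d"
    using assms(2) by (auto simp: x chain_density_def indicator_def split: if_splits)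
  then have "barycentric d t \<in> standard_simplex d"
    using open_corner_subset barycentric_in_standard_simplex by blast
  ultimately show ?thesis by (auto simp: x chain_point_def chain_support_def)
qed

text \<open>Linearity is read off from the single integral over \<open>chain_measure\<close>, where
  continuity of each \<open>h a\<close> on \<open>X\<close> supplies the integrability that
  additivity needs.\<close>

lemma chain_integral_sum:
  assumes \<sigma>: "relative_chain n d X Y \<sigma>" and \<omega>: "regular_form n d X \<omega>"
    and h: "\<And>a. a \<in> A \<Longrightarrow> continuous_on X (h a)"
  shows "chain_integral n d \<sigma> (scale_form (\<lambda>x. \<Sum>a\<in>A. c a * h a x) \<omega>) =
    (\<Sum>a\<in>A. c a * chain_integral n d \<sigma> (scale_form (h a) \<omega>))"
proof -
  have "continuous_on X (\<lambda>x. \<Sum>a\<in>A. c a * h a x)"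
    by (intro continuous_intros h)
  then have "chain_integral n d \<sigma> (scale_form (\<lambda>x. \<Sum>a\<in>A. c a * h a x) \<omega>) =
      (\<integral>x. (\<Sum>a\<in>A. c a * (h a (chain_point d x) * chain_density n d \<sigma> \<omega> x)) \<partial>chain_measure d \<sigma>)"
    by (subst chain_integral_eq[OF \<sigma> \<omega>]) (auto simp: sum_distrib_right mult.assoc)
  also have "\<dots> = (\<Sum>a\<in>A. c a * (\<integral>x. h a (chain_point d x) * chain_density n d \<sigma> \<omega> x \<partial>chain_measure d \<sigma>))"
    using integrable_chain_density[OF \<sigma> \<omega> h] by (subst Bochner_Integration.integral_sum) auto
  also have "\<dots> = (\<Sum>a\<in>A. c a * chain_integral n d \<sigma> (scale_form (h a) \<omega>))"
    by (intro sum.cong refl) (simp add: chain_integral_eq[OF \<sigma> \<omega> h])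
  finally show ?thesis .
qed

lemma poly_eval_eq_sum:
  assumes "poly_in_vars r p"
  shows "poly_eval \<iota> p x = (\<Sum>a\<in>Poly_Mapping.keys p. \<iota> (Poly_Mapping.lookup p a) *
    (\<Prod>i<r. x i ^ Poly_Mapping.lookup a i))"
  unfolding poly_eval_def
proof (rule sum.cong[OF refl])
  fix a assume "a \<in> Poly_Mapping.keys p"
  then have "Poly_Mapping.keys a \<subseteq> {..<r}" using assms by (auto simp: poly_in_vars_def)
  then have "(\<Prod>i\<in>Poly_Mapping.keys a. x i ^ Poly_Mapping.lookup a i) = (\<Prod>i<r. x i ^ Poly_Mapping.lookup a i)"
    by (intro prod.mono_neutral_left) (auto simp: in_keys_iff)
  then show "\<iota> (Poly_Mapping.lookup p a) * (\<Prod>i\<in>Poly_Mapping.keys a. x i ^ Poly_Mapping.lookup a i) =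
      \<iota> (Poly_Mapping.lookup p a) * (\<Prod>i<r. x i ^ Poly_Mapping.lookup a i)" by simp
qed

text \<open>Multiplying out two polynomials adds exponents of monomials, and integration is linear.
  Reality of the Mellin integrals thereby passes to the matrix.\<close>

lemma Q_matrix_entry:
  assumes \<sigma>: "relative_chain n d X Y \<sigma>" and \<omega>: "regular_form n d X \<omega>"
    and f: "morphism_to_affine_space n X r f"
    and m: "poly_in_vars r (m i)" "poly_in_vars r (m j)" and ij: "i < N" "j < N"
  shows "Q_matrix n d \<sigma> \<omega> f N m $$ (i, j) =
    (\<Sum>(a, b)\<in>Poly_Mapping.keys (m i) \<times> Poly_Mapping.keys (m j).
      of_int (Poly_Mapping.lookup (m i) a * Poly_Mapping.lookup (m j) b) *
      mellin_integral n d \<sigma> \<omega> r f (\<lambda>l. Poly_Mapping.lookup a l + Poly_Mapping.lookup b l))"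
proof -
  let ?K = "Poly_Mapping.keys (m i) \<times> Poly_Mapping.keys (m j)"
  let ?c = "\<lambda>ab. of_int (Poly_Mapping.lookup (m i) (fst ab) * Poly_Mapping.lookup (m j) (snd ab)) :: complex"
  let ?h = "\<lambda>ab x. \<Prod>l<r. f x l ^ (Poly_Mapping.lookup (fst ab) l + Poly_Mapping.lookup (snd ab) l)"
  have expand: "poly_eval of_int (m i) (f x) * poly_eval of_int (m j) (f x) = (\<Sum>ab\<in>?K. ?c ab * ?h ab x)" for x
    unfolding poly_eval_eq_sum[OF m(1)] poly_eval_eq_sum[OF m(2)] sum_product sum.cartesian_product
    by (intro sum.cong refl) (auto simp: power_add prod.distrib mult_ac)
  have cont: "continuous_on X (?h ab)" for ab
    by (intro continuous_on_prod continuous_on_power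
        continuous_on_product_then_coordinatewise[OF morphism_continuous[OF f]])
  have "Q_matrix n d \<sigma> \<omega> f N m $$ (i, j) = chain_integral n d \<sigma> (scale_form (\<lambda>x. \<Sum>ab\<in>?K. ?c ab * ?h ab x) \<omega>)"
    using ij by (simp add: Q_matrix_def expand del: of_int_mult)
  also have "\<dots> = (\<Sum>ab\<in>?K. ?c ab * chain_integral n d \<sigma> (scale_form (?h ab) \<omega>))"
    by (rule chain_integral_sum[OF \<sigma> \<omega> cont])
  finally show ?thesis unfolding mellin_integral_def split_def .
qed

lemma norm_det_Q_matrix_le:
  assumes \<sigma>: "relative_chain n d X Y \<sigma>" and \<omega>: "regular_form n d X \<omega>"
    and f: "morphism_to_affine_space n X r f"
  shows "fact N * cmod (Determinant.det (Q_matrix n d \<sigma> \<omega> f N m)) \<le>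
    (sup_det N m (f ` chain_support d \<sigma>))\<^sup>2 * (\<integral>x. cmod (chain_density n d \<sigma> \<omega> x) \<partial>chain_measure d \<sigma>) ^ N"
proof -
  define F where "F = (\<lambda>i x. poly_eval of_int (m i) (f (chain_point d x)))"
  have cont: "continuous_on X (\<lambda>x. poly_eval of_int (m i) (f x))" for i
    by (rule continuous_on_compose2[OF continuous_on_poly_eval morphism_continuous[OF f] subset_UNIV])
  then have cont2: "continuous_on X (\<lambda>x. poly_eval of_int (m i) (f x) * poly_eval of_int (m j) (f x))" for i j
    by (intro continuous_intros)
  have Q: "Q_matrix n d \<sigma> \<omega> f N m = Matrix.mat N N (\<lambda>(i, j).
      \<integral>x. F i x * F j x * chain_density n d \<sigma> \<omega> x \<partial>chain_measure d \<sigma>)"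
    unfolding Q_matrix_def chain_integral_eq[OF \<sigma> \<omega> cont2] F_def ..
  have comp: "compact (f ` chain_support d \<sigma>)"
    using compact_chain_support[OF \<sigma>] continuous_on_subset[OF morphism_continuous[OF f]]
    by (intro compact_continuous_image) auto
  show ?thesis
    unfolding Q
  proof (rule andreief_bound[OF sigma_finite_chain_measure])
    \<comment> \<open>The case of the constant function 1 as \<open>h\<close>.\<close>
    show "integrable (chain_measure d \<sigma>) (chain_density n d \<sigma> \<omega>)"
      using integrable_chain_density[OF \<sigma> \<omega> continuous_on_const[of X 1]] by simp
    show "integrable (chain_measure d \<sigma>) (\<lambda>x. F i x * F j x * chain_density n d \<sigma> \<omega> x)" for i j
      using integrable_chain_density[OF \<sigma> \<omega> cont2] by (simp add: F_def)
    show "cmod (Determinant.det (Matrix.mat N N (\<lambda>(i, j). F j (z i)))) \<le> sup_det N m (f ` chain_support d \<sigma>)"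
      if "\<And>i. i < N \<Longrightarrow> z i \<in> space (chain_measure d \<sigma>) \<and> chain_density n d \<sigma> \<omega> (z i) \<noteq> 0" for z
      unfolding F_def using that chain_point_in_support
      by (intro det_le_sup_det[OF comp, where z = "\<lambda>i. f (chain_point d (z i))"]) blast
  qed
qed

lemma is_Z_basis_mem:
  assumes "is_Z_basis N m M" "i < N"
  shows "m i \<in> M"
proof -
  have "(\<Sum>j<N. of_int (if j = i then 1 else 0) * m j) = (\<Sum>j<N. if j = i then m j else 0)"
    by (intro sum.cong) auto
  also have "\<dots> = m i" using assms(2) by simp
  finally have "\<exists>c :: nat \<Rightarrow> int. m i = (\<Sum>j<N. of_int (c j) * m j)"
    by (intro exI[of _ "\<lambda>j. if j = i then 1 else 0"]) (rule sym)
  then show ?thesis using assms(1) by (auto simp: is_Z_basis_def)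
qed

text \<open>The quotients of \<open>C ^ N\<close> by \<open>fact N\<close> are the terms of the
  exponential series, which converges for every \<open>C\<close>, so they tend to 0.\<close>

lemma eventually_power_le_fact:
  fixes C :: real
  obtains N\<^sub>0 :: nat where "\<And>N. N > N\<^sub>0 \<Longrightarrow> C ^ N \<le> fact N"
proof -
  have "(\<lambda>N. inverse (fact N) * C ^ N) \<longlonglongrightarrow> 0"
    by (rule summable_LIMSEQ_zero[OF summable_exp])
  then have "\<forall>\<^sub>F N in sequentially. inverse (fact N) * C ^ N < 1"
    by (rule order_tendstoD) simp
  then obtain N\<^sub>0 where N\<^sub>0: "\<And>N. N \<ge> N\<^sub>0 \<Longrightarrow> inverse (fact N) * C ^ N < 1"
    by (auto simp: eventually_sequentially)
  show ?thesis
  proof (rule that)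
    show "C ^ N \<le> fact N" if "N > N\<^sub>0" for N
      using N\<^sub>0[of N] that by (simp add: field_simps)
  qed
qed

lemma invertible_mat_det_nonzero:
  fixes A :: "'a::field Matrix.mat"
  assumes A: "A \<in> carrier_mat N N" and inv: "invertible_mat A"
  shows "Determinant.det A \<noteq> 0"
proof -
  obtain B where B: "A * B = 1\<^sub>m N" "B * A = 1\<^sub>m (dim_row B)"
    using A inv by (auto simp: invertible_mat_def inverts_mat_def)
  \<comment> \<open>Invertibility leaves the shape of \<open>B\<close> open; it is recovered by
    comparing dimensions in the two products.\<close>
  have "dim_col B = N" using arg_cong[OF B(1), of dim_col] by simp
  moreover have "dim_row B = N" using arg_cong[OF B(2), of dim_col] A by simp
  ultimately have "B \<in> carrier_mat N N" by auto
  then have "Determinant.det A * Determinant.det B = 1"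
    using det_mult[OF A] B(1) by (metis det_one)
  then show ?thesis by auto
qed

section \<open>The rational span of the Mellin integrals\<close>

lemma complex_of_real_of_rat: "complex_of_real (of_rat q) = of_rat q"
proof (cases q)
  case (Fract a b)
  then have "b \<noteq> 0" by simp
  then show ?thesis unfolding Fract(1) by (subst (1 2) of_rat_rat) simp_all
qed

text \<open>The complex numbers become a rational vector space, so that rational combinations of
  Mellin integrals can be handled as elements of a span.\<close>

interpretation rat_complex: vector_space "\<lambda>(q :: rat) (z :: complex). of_rat q * z"
  by unfold_locales (auto simp: algebra_simps of_rat_add of_rat_mult)

lemma rat_complex_span_range:
  assumes "x \<in> rat_complex.span (range I)"
  shows "\<exists>A q. finite A \<and> x = (\<Sum>a\<in>A. of_rat (q a) * I a)"
proof -
  obtain T r where T: "finite T" "T \<subseteq> range I" "x = (\<Sum>z\<in>T. of_rat (r z) * z)"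
    using assms by (auto simp: rat_complex.span_explicit)
  \<comment> \<open>Different exponents may give equal integrals; choosing one exponent per value in
    \<open>T\<close> makes the reindexing injective.\<close>
  obtain A where A: "inj_on I A" "T = I ` A"
    using T(2) subset_image_inj[of T I UNIV] by auto
  have "finite A" using T(1) A finite_image_iff by blast
  moreover have "x = (\<Sum>a\<in>A. of_rat (r (I a)) * I a)"
    using A T(3) by (simp add: sum.reindex)
  ultimately show ?thesis by (intro exI conjI)
qed

lemma rat_complex_span_real:
  assumes "x \<in> rat_complex.span S" "S \<subseteq> \<real>"
  shows "x \<in> \<real>"
proof (rule rat_complex.span_induct_alt[OF assms(1)])
  fix c :: rat and z y :: complex
  assume z: "z \<in> S" and y: "y \<in> \<real>"
  have "of_rat c \<in> (\<real> :: complex set)" by (metis complex_of_real_of_rat Reals_of_real)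
  then show "of_rat c * z + y \<in> \<real>" using z y assms(2) by auto
qed simp

text \<open>Row and column operations with rational coefficients do not leave the span. For
  \<open>D\<^sub>l Q D\<^sub>r\<close> this gives both that the entries are real and that they are
  rational combinations of Mellin integrals.\<close>

lemma rat_matrix_mult_span:
  assumes D: "D\<^sub>l \<in> carrier_mat N N" "D\<^sub>r \<in> carrier_mat N N" and Q: "Q \<in> carrier_mat N N"
    and span: "\<And>i j. i < N \<Longrightarrow> j < N \<Longrightarrow> Q $$ (i, j) \<in> rat_complex.span S"
    and ij: "i < N" "j < N"
  shows "(map_mat of_rat D\<^sub>l * Q * map_mat of_rat D\<^sub>r) $$ (i, j) \<in> rat_complex.span S"
proof -
  have left: "(map_mat of_rat D\<^sub>l * Q) $$ (i, k) \<in> rat_complex.span S" if "k < N" for k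
  proof -
    have "(map_mat of_rat D\<^sub>l * Q) $$ (i, k) = (\<Sum>l = 0..<N. of_rat (D\<^sub>l $$ (i, l)) * Q $$ (l, k))"
      using D Q ij that by (simp add: scalar_prod_def)
    also have "\<dots> \<in> rat_complex.span S"
      by (intro rat_complex.span_sum rat_complex.span_scale span) (use that in auto)
    finally show ?thesis .
  qed
  let ?M = "map_mat of_rat D\<^sub>l * Q"
  have "?M \<in> carrier_mat N N" using D Q by auto
  then have "(?M * map_mat of_rat D\<^sub>r) $$ (i, j) = (\<Sum>k = 0..<N. of_rat (D\<^sub>r $$ (k, j)) * ?M $$ (i, k))"
    using D ij by (subst index_mult_mat(1)) (auto simp: scalar_prod_def mult.commute simp del: index_mult_mat(1) assoc_mult_mat)
  also have "\<dots> \<in> rat_complex.span S"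
    by (intro rat_complex.span_sum rat_complex.span_scale left) auto
  finally show ?thesis .
qed

lemma integer_combination_of_forms:
  fixes L :: "nat \<Rightarrow> nat \<Rightarrow> complex" and e :: "nat \<Rightarrow> nat \<Rightarrow> int"
  assumes "\<And>i j. i < N \<Longrightarrow> j < N \<Longrightarrow> \<exists>c :: nat \<Rightarrow> int. L i j = (\<Sum>k<m. of_int (c k) * \<xi> k)"
  shows "\<exists>c :: nat \<Rightarrow> int. (\<Sum>i<N. \<Sum>j<N. of_int (e i j) * L i j) = (\<Sum>k<m. of_int (c k) * \<xi> k)"
proof -
  obtain c :: "nat \<Rightarrow> nat \<Rightarrow> nat \<Rightarrow> int"
    where c: "\<And>i j. i < N \<Longrightarrow> j < N \<Longrightarrow> L i j = (\<Sum>k<m. of_int (c i j k) * \<xi> k)"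
    using assms by metis
  have "(\<Sum>i<N. \<Sum>j<N. of_int (e i j) * L i j) =
      (\<Sum>i<N. \<Sum>j<N. \<Sum>k<m. of_int (e i j * c i j k) * \<xi> k)"
    by (intro sum.cong refl) (simp add: c sum_distrib_left mult.assoc)
  also have "\<dots> = (\<Sum>i<N. \<Sum>k<m. \<Sum>j<N. of_int (e i j * c i j k) * \<xi> k)"
    by (intro sum.cong refl sum.swap)
  also have "\<dots> = (\<Sum>k<m. \<Sum>i<N. \<Sum>j<N. of_int (e i j * c i j k) * \<xi> k)"
    by (rule sum.swap)
  also have "\<dots> = (\<Sum>k<m. of_int (\<Sum>i<N. \<Sum>j<N. e i j * c i j k) * \<xi> k)"
    by (simp add: sum_distrib_right)
  finally show ?thesis by (rule exI[where x = "\<lambda>k. \<Sum>i<N. \<Sum>j<N. e i j * c i j k"])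
qed

theorem theorem7p2:
  fixes n d :: nat and X :: "cpoint set" and \<omega> :: diff_form and \<sigma> :: "cpoint chain"
  assumes "smooth_affine_variety n d X"
    and "regular_form n d X \<omega>"
  shows "\<exists>N\<^sub>0 :: nat.
    \<forall>(Y :: cpoint set) (r :: nat) (f :: cpoint \<Rightarrow> cpoint) (m :: nat) (\<xi> :: nat \<Rightarrow> complex)
      (N :: nat) (\<N> :: int mpoly_nat set) (\<mm> :: nat \<Rightarrow> int mpoly_nat)
      (D\<^sub>l :: rat Matrix.mat) (D\<^sub>r :: rat Matrix.mat) (\<delta> :: real).
      divisor_on n d X Y \<longrightarrow>
      relative_chain n d X Y \<sigma> \<longrightarrow>
      morphism_to_affine_space n X r f \<longrightarrow>
      (\<forall>a. mellin_integral n d \<sigma> \<omega> r f a \<in> \<real>) \<longrightarrow>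
      (\<forall>k<m. is_period (\<xi> k)) \<longrightarrow>
      (\<forall>a. \<exists>q :: nat \<Rightarrow> rat. mellin_integral n d \<sigma> \<omega> r f a = (\<Sum>k<m. of_rat (q k) * \<xi> k)) \<longrightarrow>
      (\<forall>p\<in>\<N>. poly_in_vars r p) \<longrightarrow>
      is_Z_basis N \<mm> \<N> \<longrightarrow>
      admissible X f \<N> \<longrightarrow>
      D\<^sub>l \<in> carrier_mat N N \<longrightarrow> invertible_mat D\<^sub>l \<longrightarrow>
      D\<^sub>r \<in> carrier_mat N N \<longrightarrow> invertible_mat D\<^sub>r \<longrightarrow>
      (\<forall>i<N. \<forall>j<N. \<exists>c :: nat \<Rightarrow> int.
         (map_mat of_rat D\<^sub>l * Q_matrix n d \<sigma> \<omega> f N \<mm> * map_mat of_rat D\<^sub>r) $$ (i, j)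
           = (\<Sum>k<m. of_int (c k) * \<xi> k)) \<longrightarrow>
      \<delta> = \<bar>of_rat (Determinant.det D\<^sub>l) * of_rat (Determinant.det D\<^sub>r)\<bar> \<longrightarrow>
      N > N\<^sub>0 \<longrightarrow>
      Determinant.det (Q_matrix n d \<sigma> \<omega> f N \<mm>) \<noteq> 0 \<longrightarrow>
      (\<exists>c :: nat \<Rightarrow> int.
         (\<exists>(A :: (nat \<Rightarrow> nat) set) (q :: (nat \<Rightarrow> nat) \<Rightarrow> rat). finite A \<and>
            (\<Sum>k<m. of_int (c k) * \<xi> k) = (\<Sum>a\<in>A. of_rat (q a) * mellin_integral n d \<sigma> \<omega> r f a)) \<and>
         0 < cmod (\<Sum>k<m. of_int (c k) * \<xi> k) \<and>
         cmod (\<Sum>k<m. of_int (c k) * \<xi> k)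
           \<le> ((sup_det N \<mm> (f ` chain_support d \<sigma>))\<^sup>2 * \<delta>) powr (1 / real N))"
proof -
  \<comment> \<open>The total mass of the form along the chain. It is fixed before \<open>Y\<close>,
    \<open>r\<close>, \<open>f\<close> and the \<open>\<xi> k\<close> are introduced, so the
    threshold obtained from it is uniform in them.\<close>
  define C where "C = (\<integral>x. cmod (chain_density n d \<sigma> \<omega> x) \<partial>chain_measure d \<sigma>)"
  obtain N\<^sub>0 :: nat where N\<^sub>0: "\<And>N. N > N\<^sub>0 \<Longrightarrow> C ^ N \<le> fact N"
    using eventually_power_le_fact by blast
  show ?thesis
  proof (intro exI[of _ N\<^sub>0] allI impI, goal_cases)
    case (1 Y r f m \<xi> N \<N> \<mm> D\<^sub>l D\<^sub>r \<delta>)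
    note \<sigma> = 1(2) and f = 1(3) and real = 1(4) and vars = 1(7) and basis = 1(8)
      and D = 1(10,12) and inv = 1(11,13) and forms = 1(14) and \<delta> = 1(15) and N = 1(16) and nz = 1(17)
    note \<omega> = assms(2)
    let ?I = "mellin_integral n d \<sigma> \<omega> r f"
    define Q where "Q = Q_matrix n d \<sigma> \<omega> f N \<mm>"
    define t where "t = sup_det N \<mm> (f ` chain_support d \<sigma>)"
    define L where "L = map_mat of_rat D\<^sub>l * Q * map_mat of_rat D\<^sub>r"
    have Q: "Q \<in> carrier_mat N N" by (simp add: Q_def Q_matrix_def)
    have L: "L \<in> carrier_mat N N" using D Q by (simp add: L_def)
    have pv: "poly_in_vars r (\<mm> i)" if "i < N" for i
      using vars is_Z_basis_mem[OF basis that] by blast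
    have "Q $$ (i, j) \<in> rat_complex.span (range ?I)" if "i < N" "j < N" for i j
    proof -
      have "of_int c * ?I a \<in> rat_complex.span (range ?I)" for c a
        using rat_complex.span_scale[OF rat_complex.span_base, of "?I a" "range ?I" "of_int c"] by simp
      then show ?thesis
        unfolding Q_def Q_matrix_entry[OF \<sigma> \<omega> f pv[OF that(1)] pv[OF that(2)] that] split_def
        by (intro rat_complex.span_sum)
    qed
    then have span: "L $$ (i, j) \<in> rat_complex.span (range ?I)" if "i < N" "j < N" for i j
      unfolding L_def using that by (intro rat_matrix_mult_span[OF D Q])
    \<comment> \<open>The entries of \<open>L\<close> are rational combinations of real Mellin
      integrals, so taking real parts loses nothing and gives the real matrix that the group
      argument needs.\<close>
    define l where "l = (\<lambda>i j. Re (L $$ (i, j)))"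
    have l: "L $$ (i, j) = of_real (l i j)" if "i < N" "j < N" for i j
    proof -
      have "L $$ (i, j) \<in> \<real>"
        by (rule rat_complex_span_real[OF span[OF that]]) (use real in auto)
      then show ?thesis by (simp add: l_def)
    qed
    let ?dl = "Determinant.det (Matrix.mat N N (\<lambda>(i, j). l i j))"
    have "L = map_mat of_real (Matrix.mat N N (\<lambda>(i, j). l i j))"
      using L by (intro eq_matI) (auto simp: l)
    then have "Determinant.det L = of_real ?dl" by simp
    moreover have "Determinant.det L = of_rat (Determinant.det D\<^sub>l) * Determinant.det Q * of_rat (Determinant.det D\<^sub>r)"
      using D Q by (simp add: L_def det_mult[of _ N])
    ultimately have dl: "\<bar>?dl\<bar> = \<delta> * cmod (Determinant.det Q)"
      by (metis (no_types, lifting) \<delta> abs_mult complex_of_real_of_rat mult.assoc mult.commute norm_mult norm_of_real)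
    have "Determinant.det D\<^sub>l \<noteq> 0" "Determinant.det D\<^sub>r \<noteq> 0"
      using D inv by (auto dest: invertible_mat_det_nonzero)
    then have "\<delta> > 0" by (simp add: \<delta>)
    then have "?dl \<noteq> 0" using dl nz by (auto simp: Q_def)
    then obtain e where e: "0 < \<bar>\<Sum>i<N. \<Sum>j<N. of_int (e i j) * l i j\<bar>"
      "\<bar>\<Sum>i<N. \<Sum>j<N. of_int (e i j) * l i j\<bar> \<le> root N \<bar>?dl\<bar>"
      using small_combination_of_entries[of N l] N by auto
    \<comment> \<open>The same small number is used in two ways: as an integral form in the
      \<open>\<xi> k\<close>, since each entry of \<open>L\<close> is one, and as a rational
      combination of Mellin integrals.\<close>
    define x where "x = (\<Sum>i<N. \<Sum>j<N. of_int (e i j) * L $$ (i, j))"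
    have x: "x = of_real (\<Sum>i<N. \<Sum>j<N. of_int (e i j) * l i j)"
      by (simp add: x_def l)
    have "of_int k * L $$ (i, j) \<in> rat_complex.span (range ?I)" if "i < N" "j < N" for k i j
      using rat_complex.span_scale[OF span[OF that], of "of_int k"] by simp
    then have "x \<in> rat_complex.span (range ?I)"
      unfolding x_def by (intro rat_complex.span_sum) auto
    then have mellin: "\<exists>A q. finite A \<and> x = (\<Sum>a\<in>A. of_rat (q a) * ?I a)"
      by (rule rat_complex_span_range)
    have "\<exists>c :: nat \<Rightarrow> int. x = (\<Sum>k<m. of_int (c k) * \<xi> k)"
      unfolding x_def using forms by (intro integer_combination_of_forms) (auto simp: L_def Q_def)
    then obtain c :: "nat \<Rightarrow> int" where c: "x = (\<Sum>k<m. of_int (c k) * \<xi> k)" by blast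
    \<comment> \<open>The factorial from Andreief's identity absorbs \<open>C ^ N\<close>, leaving
      \<open>t\<^sup>2\<close> as the bound for the determinant of \<open>Q\<close>.\<close>
    have "fact N * cmod (Determinant.det Q) \<le> t\<^sup>2 * C ^ N"
      unfolding Q_def t_def C_def by (rule norm_det_Q_matrix_le[OF \<sigma> \<omega> f])
    also have "\<dots> \<le> t\<^sup>2 * fact N" using N\<^sub>0[OF N] by (intro mult_left_mono) auto
    finally have "cmod (Determinant.det Q) \<le> t\<^sup>2" by (simp add: mult.commute)
    then have "\<bar>?dl\<bar> \<le> t\<^sup>2 * \<delta>"
      using \<open>\<delta> > 0\<close> by (simp add: dl mult.commute)
    \<comment> \<open>\<open>root\<close> and \<open>powr\<close> agree here because
      \<open>N\<close> and the absolute value of the determinant are positive.\<close>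
    then have "root N \<bar>?dl\<bar> \<le> (t\<^sup>2 * \<delta>) powr (1 / real N)"
      using N \<open>?dl \<noteq> 0\<close> by (subst root_powr_inverse) (auto intro!: powr_mono2)
    then have "cmod x \<le> (t\<^sup>2 * \<delta>) powr (1 / real N)" "0 < cmod x"
      using e unfolding x norm_of_real by linarith+
    with mellin show ?case
      by (intro exI[of _ c]) (simp add: c t_def)
  qed
qed

end
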